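(* Let $T_n=\frac{1}{n+1}\binom{3n+1}{n}$ for $n\ge 0$, and let $Z_{2,m}(y)$ be the zero-run enumerator of $T_n\bmod 2$ on $0\le n<2^m$. Then $Z_{2,1}(y)=y$, and for every $m\ge 2$, $$Z_{2,m}(y)=\mathcal{F}_m\, y+\sum_{j=3}^{m-1}\mathcal{F}_{m-j}\,y^{\mathcal{J}_j}+y^{\mathcal{J}_m}.$$
   Context: For a prime $p$ and $m\ge1$, the zero-run enumerator is $Z_{p,m}(y)=\sum_R y^{|R|}$, where the sum runs over all maximal (nonempty) zero runs $R$ in the finite word $T_0,T_1,\ldots,T_{p^m-1}\pmod p$ (i.e. maximal intervals of consecutive indices in $[0,p^m-1]$ on which $T_n\equiv0\pmod p$) and $|R|$ is the length of $R$; a zero run meeting the right endpoint $p^m-1$ is counted with its truncated length inside this interval. Fibonacci numbers: $\mathcal{F}_0=0$, $\mathcal{F}_1=1$, $\mathcal{F}_{n+1}=\mathcal{F}_n+\mathcal{F}_{n-1}$. Jacobsthal numbers: $\mathcal{J}_0=0$, $\mathcal{J}_1=1$, $\mathcal{J}_{n+1}=\mathcal{J}_n+2\mathcal{J}_{n-1}$. Empty sums are $0$. *)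

theory Defs
  imports Complex_Main "HOL-Computational_Algebra.Polynomial"
    "HOL-Computational_Algebra.Primes" "HOL-Number_Theory.Fib"
begin

definition T :: "nat \<Rightarrow> nat" where
  "T n = ((3 * n + 1) choose n) div (n + 1)"

text \<open>The division in the definition of \<open>T\<close> is exact.\<close>

lemma Suc_dvd_binomial: "(n + 1) dvd ((3 * n + 1) choose n)"
proof -
  have "((3 * n + 1) choose n) * (2 * n + 1) = (n + 1) * ((3 * n + 1) choose (n + 1))"
    using binomial_absorb_comp[of "3 * n + 1" n] binomial_absorption[of n "3 * n + 1"]
    by (simp add: mult.commute del: binomial_Suc_Suc mult_Suc mult_Suc_right)
  then have "(n + 1) dvd ((3 * n + 1) choose n) * (2 * n + 1)"
    by (metis dvd_triv_left)
  moreover have "coprime (n + 1) (2 * n + 1)"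
  proof (rule coprimeI)
    fix c assume "c dvd n + 1" "c dvd 2 * n + 1"
    then have "c dvd 2 * (n + 1) - (2 * n + 1)"
      by (meson dvd_diff_nat dvd_mult)
    then show "is_unit c" by simp
  qed
  ultimately show ?thesis
    using coprime_dvd_mult_left_iff by blast
qed

lemma T_eq: "real (T n) = 1 / real (n + 1) * real ((3 * n + 1) choose n)"
  unfolding T_def using Suc_dvd_binomial[of n] by (simp add: real_of_nat_div)

definition zero_interval :: "nat \<Rightarrow> nat \<Rightarrow> nat set \<Rightarrow> bool" where
  "zero_interval p m R \<longleftrightarrow>
     (\<exists>a b. a \<le> b \<and> b < p ^ m \<and> R = {a..b}) \<and> (\<forall>n\<in>R. T n mod p = 0)"

definition zero_runs :: "nat \<Rightarrow> nat \<Rightarrow> nat set set" where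
  "zero_runs p m =
     {R. zero_interval p m R \<and> (\<forall>S. zero_interval p m S \<longrightarrow> R \<subseteq> S \<longrightarrow> S = R)}"

lemma finite_zero_runs: "finite (zero_runs p m)"
  by (rule finite_subset[of _ "Pow {..<p ^ m}"])
    (auto simp: zero_runs_def zero_interval_def)

text \<open>The enumerator is a formal polynomial in the indeterminate \<open>y = monom 1 1\<close>.\<close>

definition Z :: "nat \<Rightarrow> nat \<Rightarrow> int poly" where
  "Z p m = (\<Sum>R\<in>zero_runs p m. monom 1 (card R))"

fun jacobsthal :: "nat \<Rightarrow> nat" where
  "jacobsthal 0 = 0"
| "jacobsthal (Suc 0) = 1"
| "jacobsthal (Suc (Suc n)) = jacobsthal (Suc n) + 2 * jacobsthal n"

end

theory Submission
  imports Defs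
begin

text \<open>
  Since \<open>(2n+1) T n = binomial (3n+1) (n+1)\<close>, Lucas' theorem modulo 2 shows that \<open>T n\<close> is odd exactly
  when \<open>n\<close> is even and has no two adjacent binary ones. In particular the indices of odd terms below
  \<open>2 ^ (m+2)\<close> are those below \<open>2 ^ (m+1)\<close> together with the shifts by \<open>2 ^ (m+1)\<close> of those below \<open>2 ^ m\<close>.
  Every odd term is followed by an even one, so zero runs correspond to odd terms; and as \<open>2 ^ m\<close> is
  itself the index of an odd term, the truncated last run has the length of a genuine gap. The shift
  preserves all gaps except the one after the largest index, whose length grows from
  the \<open>m\<close>-th to the \<open>(m+2)\<close>-nd Jacobsthal number. This yields a Fibonacci-type recursion.
\<close>

section \<open>Parity of the sequence\<close>

text \<open>This is Lucas' theorem modulo 2 for the last binary digit. The four parities need a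
  joint induction: Pascal's rule derives each even row from the odd row before it, and each odd row
  from the even row before it.\<close>

lemma odd_binomial_double:
  "odd ((2 * n) choose (2 * k)) \<longleftrightarrow> odd (n choose k)"
  "even ((2 * n) choose Suc (2 * k))"
  "odd (Suc (2 * n) choose (2 * k)) \<longleftrightarrow> odd (n choose k)"
  "odd (Suc (2 * n) choose Suc (2 * k)) \<longleftrightarrow> odd (n choose k)"
proof (induction n arbitrary: k)
  case 0
  { case 1 show ?case by (cases k) simp_all }
  { case 2 show ?case by simp }
  { case 3 show ?case by (cases k) simp_all }
  { case 4 show ?case by (cases k) simp_all }
next
  case (Suc n)
  have pascal: "(2 * Suc n) choose Suc i = (Suc (2 * n) choose i) + (Suc (2 * n) choose Suc i)"
      "Suc (2 * Suc n) choose Suc i = ((2 * Suc n) choose i) + ((2 * Suc n) choose Suc i)" for i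
    by (metis binomial_Suc_Suc mult_Suc_right add_2_eq_Suc) (rule binomial_Suc_Suc)
  have double_Suc: "2 * Suc j = Suc (Suc (2 * j))" for j by simp
  have a: "odd ((2 * Suc n) choose (2 * k)) \<longleftrightarrow> odd (Suc n choose k)" for k
  proof (cases k)
    case (Suc j)
    have "odd ((2 * Suc n) choose (2 * k)) \<longleftrightarrow>
        odd ((Suc (2 * n) choose Suc (2 * j)) + (Suc (2 * n) choose (2 * Suc j)))"
      unfolding Suc double_Suc[of j] pascal(1) ..
    also have "\<dots> \<longleftrightarrow> odd ((n choose j) + (n choose Suc j))"
      by (simp only: odd_add Suc.IH(3,4))
    finally show ?thesis using Suc by simp
  qed simp
  have b: "even ((2 * Suc n) choose Suc (2 * k))" for k
    unfolding pascal(1) using Suc.IH(3,4)[of k] by (simp only: even_add) blast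
  { case 1 show ?case by (rule a) }
  { case 2 show ?case by (rule b) }
  { case 3 show ?case
    proof (cases k)
      case (Suc j)
      have "Suc (2 * Suc n) choose (2 * k) =
        ((2 * Suc n) choose Suc (2 * j)) + ((2 * Suc n) choose (2 * k))"
        unfolding Suc double_Suc[of j] pascal(2) ..
      then show ?thesis by (simp only: odd_add a b simp_thms)
    qed simp }
  { case 4 show ?case
      by (simp only: pascal(2) odd_add a b simp_thms) }
qed

section \<open>Binary digits and the parity of \<open>(3 * k) choose k\<close>\<close>

definition central :: "nat \<Rightarrow> bool" where
  "central k \<longleftrightarrow> odd ((3 * k) choose k)"

lemma central_rec:
  "central 0"
  "central (2 * k) \<longleftrightarrow> central k"
  "central (4 * k + 1) \<longleftrightarrow> central k"
  "\<not> central (4 * k + 3)"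
proof -
  show "central 0" by (simp add: central_def)
  have "central (2 * k) = odd ((2 * (3 * k)) choose (2 * k))"
    by (simp add: central_def mult.left_commute)
  then show "central (2 * k) = central k"
    by (simp only: odd_binomial_double central_def)
  have "central (2 * j + 1) = odd (Suc (2 * (3 * j + 1)) choose Suc (2 * j))" for j
  proof -
    have "3 * (2 * j + 1) = Suc (2 * (3 * j + 1))" by simp
    then show ?thesis by (simp only: central_def Suc_eq_plus1)
  qed
  then have *: "central (2 * j + 1) = odd ((3 * j + 1) choose j)" for j
    by (simp only: odd_binomial_double)
  have "central (4 * k + 1) = odd (Suc (2 * (3 * k)) choose (2 * k))"
    using *[of "2 * k"] by (simp add: mult.assoc[symmetric])
  then show "central (4 * k + 1) = central k"
    by (simp only: odd_binomial_double central_def)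
  have eq: "2 * (2 * k + 1) + 1 = 4 * k + 3" "3 * (2 * k + 1) + 1 = 2 * (3 * k + 2)"
    by simp_all
  have "central (4 * k + 3) = odd ((2 * (3 * k + 2)) choose Suc (2 * k))"
    using *[of "2 * k + 1", unfolded eq] by (simp only: Suc_eq_plus1)
  then show "\<not> central (4 * k + 3)"
    by (simp only: odd_binomial_double not_not)
qed

text \<open>A new leading one is harmless exactly when the digit below it is zero. Since
  \<open>central_rec\<close> works at the low end, the induction strips final digits; it is a strong
  one because dropping 01 lowers the exponent by two.\<close>

lemma central_add_power:
  "n < 2 ^ Suc m \<Longrightarrow> central (2 ^ Suc m + n) \<longleftrightarrow> n < 2 ^ m \<and> central n"
proof (induction m arbitrary: n rule: less_induct)
  case (less m)
  have one: "central 1" and three: "\<not> central 3"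
    using central_rec(3,4)[of 0] central_rec(1) by simp_all
  consider j where "n = 2 * j" | i where "n = 4 * i + 1" | i where "n = 4 * i + 3"
  proof -
    have "(\<exists>j. n = 2 * j) \<or> (\<exists>i. n = 4 * i + 1) \<or> (\<exists>i. n = 4 * i + 3)"
      by presburger
    then show ?thesis using that by blast
  qed
  then show ?case
  proof cases
    case 1
    have "central (2 ^ Suc m + n) = central (2 ^ m + j)"
      using central_rec(2)[of "2 ^ m + j"] 1 by simp
    moreover have "central n = central j" using central_rec(2) 1 by simp
    moreover have "central (2 ^ m + j) \<longleftrightarrow> n < 2 ^ m \<and> central j"
    proof (cases m)
      case 0
      then show ?thesis using less.prems 1 one central_rec(1) by simp
    next
      case (Suc k)
      then show ?thesis using less.IH[of k j] less.prems 1 by simp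
    qed
    ultimately show ?thesis by simp
  next
    case 2
    show ?thesis
    proof (cases m)
      case 0
      then have "n = 1" using less.prems 2 by simp
      then show ?thesis using three 0 by (simp add: numeral_3_eq_3)
    next
      case (Suc k)
      have "central (2 ^ Suc m + n) = central (2 ^ k + i)"
        using central_rec(3)[of "2 ^ k + i"] 2 Suc by (simp add: algebra_simps)
      moreover have "central n = central i" using central_rec(3) 2 by simp
      moreover have "central (2 ^ k + i) \<longleftrightarrow> n < 2 ^ m \<and> central i"
      proof (cases k)
        case 0
        then have "i = 0" using less.prems 2 Suc by simp
        then show ?thesis using 0 2 Suc one central_rec(1) by simp
      next
        case k: (Suc l)
        have "i < 2 ^ Suc l" "n < 2 ^ m \<longleftrightarrow> i < 2 ^ l"
          using less.prems 2 Suc k by auto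
        then show ?thesis using less.IH[of l i] 2 Suc k by auto
      qed
      ultimately show ?thesis by simp
    qed
  next
    case 3
    then have "m \<noteq> 0" using less.prems by (intro notI) simp
    then obtain k where k: "m = Suc k" by (cases m) auto
    have "\<not> central (4 * (2 ^ k + i) + 3)" by (rule central_rec(4))
    moreover have "2 ^ Suc m + n = 4 * (2 ^ k + i) + 3" using 3 k by simp
    ultimately have "\<not> central (2 ^ Suc m + n)" by (simp only: not_False_eq_True)
    then show ?thesis using central_rec(4) 3 by simp
  qed
qed

section \<open>Transfer of the digit criterion to \<open>T\<close>\<close>

lemma T_mult: "T n * (2 * n + 1) = (3 * n + 1) choose (n + 1)"
proof -
  have "((3 * n + 1) choose n) * (2 * n + 1) = (n + 1) * ((3 * n + 1) choose (n + 1))"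
    using binomial_absorb_comp[of "3 * n + 1" n] binomial_absorption[of n "3 * n + 1"]
    by (simp add: mult.commute del: binomial_Suc_Suc mult_Suc mult_Suc_right)
  moreover have "(3 * n + 1) choose n = (n + 1) * T n"
    unfolding T_def using Suc_dvd_binomial[of n] by (simp only: dvd_mult_div_cancel)
  ultimately have "(n + 1) * (T n * (2 * n + 1)) = (n + 1) * ((3 * n + 1) choose (n + 1))"
    by (simp only: mult.assoc)
  then show ?thesis by (simp only: mult_cancel1) simp
qed

text \<open>The factor \<open>2 * n + 1\<close> in \<open>T_mult\<close> is odd, so it does not
  affect parity; at \<open>n = 2 * k\<close> the remaining binomial loses one binary digit and
  becomes \<open>(3 * k) choose k\<close>.\<close>

lemma odd_T_double: "odd (T (2 * k)) \<longleftrightarrow> central k"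
proof -
  have "odd (T (2 * k)) \<longleftrightarrow> odd (T (2 * k) * (2 * (2 * k) + 1))" by simp
  also have "\<dots> \<longleftrightarrow> odd (Suc (2 * (3 * k)) choose Suc (2 * k))"
    unfolding T_mult by (simp add: mult.left_commute del: binomial_Suc_Suc)
  finally show ?thesis by (simp only: odd_binomial_double central_def)
qed

text \<open>One digit reduction leaves \<open>X = (3 * k + 2) choose (k + 1)\<close>. Absorption
  relates it to \<open>Y = (3 * k + 3) choose (k + 1)\<close>, and cancelling \<open>k + 1\<close>
  gives \<open>2 * Y = 3 * X\<close>, so \<open>X\<close> is even.\<close>

lemma even_T_odd: "even (T (2 * k + 1))"
proof -
  have eq: "3 * (2 * k + 1) + 1 = 2 * (3 * k + 2)" "2 * k + 1 + 1 = 2 * (k + 1)" by simp_all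
  have "odd (T (2 * k + 1)) \<longleftrightarrow> odd (T (2 * k + 1) * (2 * (2 * k + 1) + 1))" by simp
  also have "\<dots> \<longleftrightarrow> odd ((3 * k + 2) choose (k + 1))"
    unfolding T_mult eq by (simp only: odd_binomial_double)
  finally have iff: "odd (T (2 * k + 1)) \<longleftrightarrow> odd ((3 * k + 2) choose (k + 1))" .
  have "even ((3 * k + 2) choose (k + 1))"
  proof -
    define X Y where "X = (3 * k + 2) choose (k + 1)" and "Y = (3 * k + 3) choose (k + 1)"
    have sub: "3 * k + 3 - (k + 1) = 2 * (k + 1)" "3 * k + 3 - 1 = 3 * k + 2" by simp_all
    have "2 * (k + 1) * Y = (3 * k + 3) * X"
      using binomial_absorb_comp[of "3 * k + 3" "k + 1", unfolded sub] by (simp only: X_def Y_def)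
    then have "(k + 1) * (2 * Y) = (k + 1) * (3 * X)" by (simp add: algebra_simps)
    then have "2 * Y = 3 * X" by (simp only: mult_cancel1) simp
    then show ?thesis unfolding X_def[symmetric] by presburger
  qed
  then show ?thesis using iff by blast
qed

lemma odd_T_imp_even: "odd (T n) \<Longrightarrow> even n"
  using even_T_odd by (metis oddE)

lemma odd_T_0: "odd (T 0)"
  by (simp add: T_def)

lemma odd_T_add_power:
  assumes "n < 2 ^ Suc m"
  shows "odd (T (2 ^ Suc m + n)) \<longleftrightarrow> n < 2 ^ m \<and> odd (T n)"
proof (cases "even n")
  case False
  then have "odd (2 ^ Suc m + n)" by simp
  then show ?thesis using odd_T_imp_even False by blast
next
  case True
  then obtain k where k: "n = 2 * k" by blast
  have eq: "odd (T (2 ^ Suc m + n)) = central (2 ^ m + k)"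
    using odd_T_double[of "2 ^ m + k"] k by simp
  show ?thesis
  proof (cases m)
    case 0
    then have "k = 0" using k assms by simp
    then show ?thesis
      using 0 eq k central_rec(1) central_rec(3)[of 0] odd_T_0 by (simp add: numeral_2_eq_2)
  next
    case (Suc l)
    then show ?thesis
      using central_add_power[of k l] k assms odd_T_double[of k] eq by simp
  qed
qed

lemma odd_T_power: "odd (T (2 ^ Suc m))"
  using odd_T_add_power[of 0 m] odd_T_0 by simp

section \<open>Gaps between odd terms\<close>

definition odd_below :: "nat \<Rightarrow> nat set" where
  "odd_below m = {n. n < 2 ^ m \<and> odd (T n)}"

text \<open>The search is not confined to indices below \<open>2 ^ m\<close>, so a gap does not
  depend on \<open>m\<close>.\<close>

definition next_odd :: "nat \<Rightarrow> nat" where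
  "next_odd s = (LEAST t. s < t \<and> odd (T t))"

lemma next_odd: "s < next_odd s" "odd (T (next_odd s))"
proof -
  have "s < 2 ^ Suc s" by (meson Suc_lessD less_exp)
  then have "\<exists>t. s < t \<and> odd (T t)" using odd_T_power by blast
  then have "s < next_odd s \<and> odd (T (next_odd s))"
    unfolding next_odd_def by (rule LeastI_ex)
  then show "s < next_odd s" "odd (T (next_odd s))" by auto
qed

lemma next_odd_le: "s < t \<Longrightarrow> odd (T t) \<Longrightarrow> next_odd s \<le> t"
  unfolding next_odd_def by (rule Least_le) simp

lemma next_oddI:
  assumes "s < t" "odd (T t)" "\<And>u. s < u \<Longrightarrow> u < t \<Longrightarrow> even (T u)"
  shows "next_odd s = t"
  using next_odd[of s] next_odd_le[of s t] assms by (metis le_neq_implies_less)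

lemma next_odd_ge:
  assumes "odd (T s)"
  shows "s + 2 \<le> next_odd s"
proof -
  have "even s" "even (next_odd s)" using assms next_odd(2) odd_T_imp_even by blast+
  then show ?thesis using next_odd(1)[of s] by presburger
qed

lemma finite_odd_below [simp]: "finite (odd_below m)"
  by (simp add: odd_below_def)

definition run :: "nat \<Rightarrow> nat set" where
  "run s = {s<..<next_odd s}"

lemma even_T_run: "n \<in> run s \<Longrightarrow> even (T n)"
  unfolding run_def using next_odd_le by fastforce

text \<open>The run is nonempty and both of its neighbours \<open>s\<close> and
  \<open>next_odd s\<close> carry odd terms, so an interval of even terms containing the run cannot
  extend past either end.\<close>

lemma run_maximal:
  assumes "odd (T s)" "run s \<subseteq> {a..b}" "\<And>n. n \<in> {a..b} \<Longrightarrow> even (T n)"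
  shows "run s = {a..b}"
proof -
  have "s + 1 \<in> run s" "next_odd s - 1 \<in> run s"
    using next_odd_ge[OF assms(1)] by (auto simp: run_def)
  then have "a \<le> s + 1" "next_odd s - 1 \<le> b" using assms(2) by auto
  moreover have "s \<notin> {a..b}" "next_odd s \<notin> {a..b}"
    using assms(1,3) next_odd(2) by blast+
  ultimately have "{a..b} \<subseteq> run s"
    using next_odd_ge[OF assms(1)] by (auto simp: run_def)
  then show ?thesis using assms(2) by blast
qed

section \<open>Maximal zero runs as gaps\<close>

lemma zero_interval_2_iff:
  "zero_interval 2 m R \<longleftrightarrow>
    (\<exists>a b. a \<le> b \<and> b < 2 ^ m \<and> R = {a..b}) \<and> (\<forall>n\<in>R. even (T n))"
  by (simp only: zero_interval_def even_iff_mod_2_eq_zero)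

text \<open>The run stays inside the range because \<open>2 ^ Suc m\<close> is itself the index of
  an odd term. This fails for \<open>2 ^ 0\<close>, as \<open>T 1 = 2\<close>; hence the exponent
  \<open>Suc m\<close>.\<close>

lemma zero_interval_run:
  assumes "s \<in> odd_below (Suc m)"
  shows "zero_interval 2 (Suc m) (run s)"
proof -
  have s: "odd (T s)" "s < 2 ^ Suc m" using assms by (auto simp: odd_below_def)
  have "run s = {s + 1..next_odd s - 1}" "s + 1 \<le> next_odd s - 1"
    using next_odd_ge[OF s(1)] by (auto simp: run_def)
  moreover have "next_odd s - 1 < 2 ^ Suc m"
    using next_odd_le[OF s(2) odd_T_power] next_odd(1)[of s] by linarith
  ultimately show ?thesis
    unfolding zero_interval_2_iff using even_T_run by blast
qed

lemma zero_interval_subset_run: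
  assumes "zero_interval 2 m R"
  obtains s where "s \<in> odd_below m" "R \<subseteq> run s"
proof -
  obtain a b where ab: "a \<le> b" "b < 2 ^ m" "R = {a..b}" and R: "\<forall>n\<in>R. even (T n)"
    using assms unfolding zero_interval_2_iff by blast
  \<comment> \<open>The required \<open>s\<close> is the largest odd-term index to the left of the
    interval; one exists because \<open>T 0\<close> is odd.\<close>
  define A where "A = {x. x < a \<and> odd (T x)}"
  have A_iff: "x \<in> A \<longleftrightarrow> x < a \<and> odd (T x)" for x by (simp add: A_def)
  have "0 \<notin> R" using R odd_T_0 by blast
  then have "0 \<in> A" using ab odd_T_0 A_iff by simp
  moreover have fin: "finite A" by (simp add: A_def)
  ultimately have s: "Max A \<in> A" using Max_in by blast
  have "b < next_odd (Max A)"
  proof (rule ccontr)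
    assume "\<not> b < next_odd (Max A)"
    moreover have "next_odd (Max A) \<notin> {a..b}" using next_odd(2) R ab(3) by blast
    ultimately have "next_odd (Max A) < a" by simp
    then have "next_odd (Max A) \<in> A" using next_odd(2) A_iff by blast
    then have "next_odd (Max A) \<le> Max A" by (rule Max_ge[OF fin])
    then show False using next_odd(1)[of "Max A"] by linarith
  qed
  moreover have "Max A < a" "odd (T (Max A))" using s A_iff by blast+
  ultimately have "R \<subseteq> run (Max A)" "Max A \<in> odd_below m"
    using ab by (force simp: run_def odd_below_def)+
  then show ?thesis using that by blast
qed

lemma zero_runs_eq: "zero_runs 2 (Suc m) = run ` odd_below (Suc m)"
proof (intro equalityI subsetI)
  fix R assume "R \<in> zero_runs 2 (Suc m)"
  then have R: "zero_interval 2 (Suc m) R"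
    "\<And>S. zero_interval 2 (Suc m) S \<Longrightarrow> R \<subseteq> S \<Longrightarrow> S = R"
    by (simp_all add: zero_runs_def)
  obtain s where s: "s \<in> odd_below (Suc m)" "R \<subseteq> run s"
    by (rule zero_interval_subset_run[OF R(1)])
  have "run s = R" by (rule R(2)[OF zero_interval_run[OF s(1)] s(2)])
  then show "R \<in> run ` odd_below (Suc m)" using s(1) by blast
next
  fix R assume "R \<in> run ` odd_below (Suc m)"
  then obtain s where s: "s \<in> odd_below (Suc m)" "R = run s" by blast
  have "S = R" if S: "zero_interval 2 (Suc m) S" "R \<subseteq> S" for S
  proof -
    obtain a b where ab: "S = {a..b}" and even: "\<forall>n\<in>S. even (T n)"
      using S(1) unfolding zero_interval_2_iff by blast
    have "odd (T s)" using s(1) by (simp add: odd_below_def)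
    then have "run s = {a..b}" by (rule run_maximal) (use S(2) s(2) ab even in blast)+
    then show ?thesis by (simp only: ab s(2))
  qed
  then show "R \<in> zero_runs 2 (Suc m)"
    using zero_interval_run[OF s(1)] s(2) by (simp add: zero_runs_def)
qed

text \<open>Since runs are nonempty, \<open>s\<close> can be recovered from \<open>run s\<close>.
  This allows the sum over runs to be reindexed by odd terms.\<close>

lemma inj_on_run: "inj_on run (odd_below m)"
proof (rule inj_onI)
  fix s t assume st: "s \<in> odd_below m" "t \<in> odd_below m" "run s = run t"
  have "s + 1 \<in> run s" "t + 1 \<in> run t"
    using st(1,2) next_odd_ge by (force simp: run_def odd_below_def)+
  then have "t + 1 \<in> run s" "s + 1 \<in> run t" by (simp_all only: st(3))
  then have "s < t + 1" "t < s + 1" unfolding run_def greaterThanLessThan_iff by blast+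
  then show "s = t" by linarith
qed

definition gap_enum :: "nat \<Rightarrow> int poly" where
  "gap_enum m = (\<Sum>s\<in>odd_below m. monom 1 (card (run s)))"

lemma Z_eq_gap_enum: "Z 2 (Suc m) = gap_enum (Suc m)"
  unfolding Z_def zero_runs_eq gap_enum_def by (simp add: sum.reindex[OF inj_on_run])

section \<open>The recursion\<close>

text \<open>Indices are split by their leading digit; if it is one, \<open>odd_T_add_power\<close>
  forces the next digit to be zero. This is the source of the Fibonacci numbers.\<close>

lemma odd_below_rec:
  "odd_below (Suc (Suc m)) = odd_below (Suc m) \<union> (+) (2 ^ Suc m) ` odd_below m"
proof (intro equalityI subsetI)
  fix n assume n: "n \<in> odd_below (Suc (Suc m))"
  show "n \<in> odd_below (Suc m) \<union> (+) (2 ^ Suc m) ` odd_below m"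
  proof (cases "n < 2 ^ Suc m")
    case False
    then obtain r where r: "n = 2 ^ Suc m + r" by (metis le_iff_add not_less)
    then have "r \<in> odd_below m"
      using n odd_T_add_power[of r m] by (auto simp: odd_below_def)
    then show ?thesis using r by blast
  qed (use n in \<open>auto simp: odd_below_def\<close>)
next
  fix n assume "n \<in> odd_below (Suc m) \<union> (+) (2 ^ Suc m) ` odd_below m"
  moreover have "2 ^ Suc m + r \<in> odd_below (Suc (Suc m))" if "r \<in> odd_below m" for r
    using that odd_T_add_power[of r m] by (auto simp: odd_below_def)
  ultimately show "n \<in> odd_below (Suc (Suc m))" by (auto simp: odd_below_def)
qed

section \<open>The largest index of an odd term\<close>

lemma jacobsthal_add: "jacobsthal (Suc n) + jacobsthal n = 2 ^ n"
  by (induction n) auto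

text \<open>This is the maximum of \<open>odd_below m\<close>, written so that the gap from it to
  \<open>2 ^ m\<close> visibly has Jacobsthal length. For even \<open>m\<close> its binary form is
  1010...10.\<close>

definition last_odd :: "nat \<Rightarrow> nat" where
  "last_odd m = 2 ^ m - 1 - jacobsthal m"

lemma last_odd_add: "last_odd m + jacobsthal m + 1 = 2 ^ m"
proof -
  have "1 \<le> jacobsthal (Suc m)" by (induction m) auto
  then show ?thesis using jacobsthal_add[of m] by (simp add: last_odd_def)
qed

lemma last_odd_rec: "last_odd (Suc (Suc m)) = 2 ^ Suc m + last_odd m"
  using last_odd_add[of m] last_odd_add[of "Suc (Suc m)"] jacobsthal_add[of m] by simp

lemma odd_below_0: "odd_below 0 = {0}"
  using odd_T_0 by (auto simp: odd_below_def)

lemma odd_below_1: "odd_below (Suc 0) = {0}"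
  using odd_T_0 odd_T_imp_even[of 1] by (auto simp: odd_below_def less_2_cases_iff)

lemma last_odd_in: "last_odd m \<in> odd_below m"
proof (induction m rule: induct_nat_012)
  case 0 then show ?case by (simp add: odd_below_0 last_odd_def)
next
  case 1 then show ?case by (simp add: odd_below_1 last_odd_def)
next
  case (ge2 m) then show ?case by (simp only: odd_below_rec last_odd_rec) blast
qed

lemma last_odd_ge: "s \<in> odd_below m \<Longrightarrow> s \<le> last_odd m"
proof (induction m arbitrary: s rule: induct_nat_012)
  case 0 then show ?case by (simp add: odd_below_0)
next
  case 1 then show ?case by (simp add: odd_below_1)
next
  case (ge2 m)
  then show ?case unfolding odd_below_rec last_odd_rec
    by (auto simp: odd_below_def)
qed

lemma card_run_last_odd: "card (run (last_odd (Suc m))) = jacobsthal (Suc m)"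
proof -
  have "next_odd (last_odd (Suc m)) = 2 ^ Suc m"
  proof (rule next_oddI)
    show "last_odd (Suc m) < 2 ^ Suc m" using last_odd_add[of "Suc m"] by linarith
    show "odd (T (2 ^ Suc m))" by (rule odd_T_power)
    show "even (T u)" if "last_odd (Suc m) < u" "u < 2 ^ Suc m" for u
      using last_odd_ge[of u "Suc m"] that by (auto simp: odd_below_def)
  qed
  then show ?thesis unfolding run_def using last_odd_add[of "Suc m"] by simp
qed

text \<open>If \<open>s\<close> is not the largest index, its whole gap and
  \<open>next_odd s\<close> lie below \<open>2 ^ m\<close>, where shifting by
  \<open>2 ^ Suc m\<close> preserves the parity of \<open>T\<close>.\<close>

lemma card_run_shift:
  assumes "s \<in> odd_below m" "s \<noteq> last_odd m"
  shows "card (run (2 ^ Suc m + s)) = card (run s)"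
proof -
  have "s < last_odd m" using assms last_odd_ge by force
  then have le: "next_odd s < 2 ^ m"
    using next_odd_le[of s "last_odd m"] last_odd_in[of m] by (simp add: odd_below_def)
  have "next_odd (2 ^ Suc m + s) = 2 ^ Suc m + next_odd s"
  proof (rule next_oddI)
    show "2 ^ Suc m + s < 2 ^ Suc m + next_odd s" using next_odd(1) by simp
    show "odd (T (2 ^ Suc m + next_odd s))"
      using odd_T_add_power[of "next_odd s" m] le next_odd(2) by simp
    fix u assume u: "2 ^ Suc m + s < u" "u < 2 ^ Suc m + next_odd s"
    then have "2 ^ Suc m \<le> u" by linarith
    then obtain r where r: "u = 2 ^ Suc m + r" using le_Suc_ex by blast
    then have "r \<in> run s" using u by (simp add: run_def)
    then have "even (T r)" by (rule even_T_run)
    then show "even (T u)" using odd_T_add_power[of r m] r u le by simp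
  qed
  then show ?thesis by (simp add: run_def)
qed

text \<open>Index \<open>m = 0\<close> is excluded because the only gap there has length 1, not \<open>jacobsthal 0 = 0\<close>.\<close>

lemma gap_enum_rec:
  "gap_enum (m + 3) - monom 1 (jacobsthal (m + 3)) =
    gap_enum (m + 2) + (gap_enum (m + 1) - monom 1 (jacobsthal (m + 1)))"
proof -
  let ?f = "\<lambda>s. monom (1::int) (card (run s))"
  let ?k = "Suc m"
  let ?B = "odd_below ?k - {last_odd ?k}"
  have split: "gap_enum n = ?f (last_odd n) + (\<Sum>s\<in>odd_below n - {last_odd n}. ?f s)" for n
    unfolding gap_enum_def by (rule sum.remove) (simp_all add: last_odd_in)
  have "gap_enum (Suc (Suc ?k)) = gap_enum (Suc ?k) + (\<Sum>s\<in>odd_below ?k. ?f (2 ^ Suc ?k + s))"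
    unfolding gap_enum_def odd_below_rec[of ?k]
    by (subst sum.union_disjoint) (auto simp: odd_below_def sum.reindex)
  also have "(\<Sum>s\<in>odd_below ?k. ?f (2 ^ Suc ?k + s)) =
      ?f (2 ^ Suc ?k + last_odd ?k) + (\<Sum>s\<in>?B. ?f (2 ^ Suc ?k + s))"
    by (rule sum.remove) (simp_all add: last_odd_in)
  also have "(\<Sum>s\<in>?B. ?f (2 ^ Suc ?k + s)) = (\<Sum>s\<in>?B. ?f s)"
    by (rule sum.cong[OF refl], subst card_run_shift) simp_all
  also have "\<dots> = gap_enum ?k - monom 1 (jacobsthal ?k)"
    by (simp only: split card_run_last_odd add_diff_cancel_left')
  \<comment> \<open>The one exceptional shifted index is the largest index two levels up, so its gap
    reaches to the next power of two.\<close>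
  also have "?f (2 ^ Suc ?k + last_odd ?k) = monom 1 (jacobsthal (Suc (Suc ?k)))"
    using card_run_last_odd[of "Suc ?k"] by (simp only: last_odd_rec)
  finally have "gap_enum (Suc (Suc ?k)) - monom 1 (jacobsthal (Suc (Suc ?k))) =
      gap_enum (Suc ?k) + (gap_enum ?k - monom 1 (jacobsthal ?k))"
    by (simp only: diff_eq_eq add.assoc add.commute)
  moreover have "m + 3 = Suc (Suc ?k)" "m + 2 = Suc ?k" "m + 1 = ?k" by simp_all
  ultimately show ?thesis by (simp only:)
qed

section \<open>Initial values and closed form\<close>

lemma gap_enum_1: "gap_enum 1 = monom 1 1"
  using card_run_last_odd[of 0] by (simp add: gap_enum_def odd_below_1 last_odd_def)

lemma gap_enum_2: "gap_enum 2 = monom 1 1 + monom 1 1"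
proof -
  have "odd_below 2 = {0, 2}"
    using odd_below_rec[of 0] by (simp add: odd_below_0 odd_below_1 numeral_2_eq_2 insert_commute)
  moreover have "card (run 0) = 1" "card (run 2) = 1"
    using card_run_last_odd[of 0] card_run_last_odd[of 1]
    by (simp_all add: last_odd_def numeral_2_eq_2)
  ultimately show ?thesis by (simp add: gap_enum_def)
qed

text \<open>In the recursion the last-gap monomial of level \<open>m - 2\<close> cancels, while that
  of level \<open>m - 1\<close> persists as the new summand \<open>j = m - 1\<close>. All other
  coefficients add by the Fibonacci rule.\<close>

lemma gap_enum_eq:
  "gap_enum (n + 2) = smult (int (fib (n + 2))) (monom 1 1)
    + (\<Sum>j = 3..n + 1. smult (int (fib (n + 2 - j))) (monom 1 (jacobsthal j)))
    + monom 1 (jacobsthal (n + 2))"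
proof (induction n rule: induct_nat_012)
  case 0
  have "0 + 2 = (2::nat)" "{3..0 + 1::nat} = {}" "jacobsthal 2 = 1" "fib 2 = 1"
    by (simp_all add: numeral_2_eq_2)
  then show ?case
    by (simp only: gap_enum_2 of_nat_1 smult_1_left sum.empty add_0_right)
next
  case 1
  have eqs: "Suc 0 + 2 = 3" "0 + 3 = (3::nat)" "0 + 2 = (2::nat)" "0 + 1 = (1::nat)"
    "jacobsthal 3 = 3" "jacobsthal 1 = 1" "fib 3 = 2" "{3..Suc 0 + 1} = {}"
    by (simp_all add: numeral_3_eq_3)
  \<comment> \<open>The bracket in \<open>gap_enum_rec\<close> vanishes here: the only gap at level
    1 is the last one.\<close>
  have "gap_enum 3 = monom 1 1 + monom 1 1 + monom 1 3"
    using gap_enum_rec[of 0] unfolding eqs gap_enum_1 gap_enum_2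
    by (simp only: diff_self add_0_right diff_eq_eq)
  also have "monom 1 1 + monom 1 1 = smult 2 (monom (1::int) 1)"
    by (simp add: add_monom smult_monom)
  finally show ?case
    unfolding eqs by (simp only: sum.empty add_0_right of_nat_numeral)
next
  case (ge2 n)
  let ?t = "\<lambda>i j. smult (int (fib (i - j))) (monom (1::int) (jacobsthal j))"
  \<comment> \<open>The bound on \<open>j\<close> keeps the natural-number subtractions from
    truncating.\<close>
  have fib: "?t (n + 4) j = ?t (n + 3) j + ?t (n + 2) j" if j: "j \<le> n + 2" for j
  proof -
    have "n + 4 - j = Suc (Suc (n + 2 - j))" "n + 3 - j = Suc (n + 2 - j)"
      using j by linarith+
    then show ?thesis by (simp only: fib.simps(3) of_nat_add smult_add_left)
  qed
  have "(\<Sum>j = 3..n + 3. ?t (n + 4) j) =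
      (\<Sum>j = 3..n + 2. ?t (n + 4) j) + monom 1 (jacobsthal (n + 3))"
  proof -
    have "(\<Sum>j = 3..Suc (n + 2). ?t (n + 4) j) =
        (\<Sum>j = 3..n + 2. ?t (n + 4) j) + ?t (n + 4) (Suc (n + 2))"
      by (rule sum.cl_ivl_Suc[THEN trans]) simp
    \<comment> \<open>The top summand has coefficient \<open>fib 1 = 1\<close> and matches the
      last-gap monomial of \<open>gap_enum (n + 3)\<close>.\<close>
    moreover have "n + 3 = Suc (n + 2)" "fib (n + 4 - Suc (n + 2)) = 1" by simp_all
    ultimately show ?thesis by (simp only: of_nat_1 smult_1_left)
  qed
  also have "(\<Sum>j = 3..n + 2. ?t (n + 4) j) =
      (\<Sum>j = 3..n + 2. ?t (n + 3) j) + (\<Sum>j = 3..n + 2. ?t (n + 2) j)"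
    unfolding sum.distrib[symmetric] by (rule sum.cong[OF refl], rule fib) simp
  \<comment> \<open>The extra index \<open>j = n + 2\<close> contributes nothing because
    \<open>fib 0 = 0\<close>.\<close>
  also have "(\<Sum>j = 3..n + 2. ?t (n + 2) j) = (\<Sum>j = 3..n + 1. ?t (n + 2) j)"
  proof (rule sum.mono_neutral_right)
    show "\<forall>j\<in>{3..n + 2} - {3..n + 1}. ?t (n + 2) j = 0"
    proof
      fix j assume "j \<in> {3..n + 2} - {3..n + 1}"
      then have "n + 2 - j = 0" by auto
      then show "?t (n + 2) j = 0" by (simp only: fib.simps(1) of_nat_0 smult_0_left)
    qed
  qed simp_all
  finally have s: "(\<Sum>j = 3..n + 3. ?t (n + 4) j) =
     (\<Sum>j = 3..n + 2. ?t (n + 3) j) + (\<Sum>j = 3..n + 1. ?t (n + 2) j)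
      + monom 1 (jacobsthal (n + 3))" .
  have shifts: "Suc n + 2 = n + 3" "Suc n + 1 = n + 2" "Suc (Suc n) + 2 = n + 4"
    "Suc (Suc n) + 1 = n + 3" "n + 1 + 3 = n + 4" "n + 1 + 2 = n + 3" "n + 1 + 1 = n + 2" by simp_all
  have f: "fib (n + 4) = fib (n + 3) + fib (n + 2)"
    using fib.simps(3)[of "n + 2"] by (simp add: numeral_eq_Suc)
  have IH: "gap_enum (n + 3) = smult (int (fib (n + 3))) (monom 1 1)
    + (\<Sum>j = 3..n + 2. ?t (n + 3) j) + monom 1 (jacobsthal (n + 3))"
    using ge2(2) by (simp only: shifts)
  have rec: "gap_enum (n + 4) =
    gap_enum (n + 3) + (gap_enum (n + 2) - monom 1 (jacobsthal (n + 2))) + monom 1 (jacobsthal (n + 4))"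
    using gap_enum_rec[of "n + 1"] by (simp only: shifts diff_eq_eq)
  have "gap_enum (n + 4) = smult (int (fib (n + 4))) (monom 1 1)
    + (\<Sum>j = 3..n + 3. ?t (n + 4) j) + monom 1 (jacobsthal (n + 4))"
    unfolding rec s f IH ge2(1) by (simp add: smult_add_left)
  then show ?case by (simp only: shifts)
qed

theorem theorem3p3:
  shows "Z 2 1 = monom 1 1 \<and>
    (\<forall>m\<ge>2. Z 2 m = smult (int (fib m)) (monom 1 1)
        + (\<Sum>j = 3..m - 1. smult (int (fib (m - j))) (monom 1 (jacobsthal j)))
        + monom 1 (jacobsthal m))"
proof (intro conjI allI impI)
  show "Z 2 1 = monom 1 1" using Z_eq_gap_enum[of 0] gap_enum_1 by simp
  fix m :: nat assume "2 \<le> m"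
  then obtain n where m: "m = n + 2" by (metis le_add_diff_inverse2)
  have "Z 2 m = gap_enum m" using Z_eq_gap_enum[of "n + 1"] m by simp
  then show "Z 2 m = smult (int (fib m)) (monom 1 1)
        + (\<Sum>j = 3..m - 1. smult (int (fib (m - j))) (monom 1 (jacobsthal j)))
        + monom 1 (jacobsthal m)"
    using gap_enum_eq[of n] m by simp
qed

end
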